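(* For real $x>1$ let $\theta(x)=(2\zeta(x)\Gamma(x+1))^{\frac{1}{x}}$, where $\zeta(x)=\sum_{n=1}^{\infty}\frac{1}{n^x}$ is the Riemann zeta function and $\Gamma$ is the gamma function. Then $\log\theta(x)$ is strictly increasing for $x\geq 6$. *)

theory Defs
  imports "HOL-Analysis.Analysis"
begin

(* Only meaningful for x > 1, where the series converges (see zeta_summable). *)
definition zeta :: "real \<Rightarrow> real" where
  "zeta x = (\<Sum>n. 1 / real (Suc n) powr x)"

definition theta :: "real \<Rightarrow> real" where
  "theta x = (2 * zeta x * Gamma (x + 1)) powr (1 / x)"

lemma zeta_summable:
  assumes "x > 1"
  shows "summable (\<lambda>n. 1 / real (Suc n) powr x)"
proof -
  have "summable (\<lambda>n. real n powr (- x))"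
    using assms by (simp add: summable_real_powr_iff)
  then have "summable (\<lambda>n. real (Suc n) powr (- x))"
    by (subst summable_Suc_iff)
  then show ?thesis
    by (simp add: powr_minus_divide)
qed

end

theory Submission
  imports Defs
begin

text \<open>
  Write \<open>f x = ln (2 * zeta x * Gamma (x + 1))\<close>, so that \<open>ln (theta x) = f x / x\<close>. Both factors
  are log-convex: \<open>Gamma\<close> by Bohr and Mollerup, and \<open>zeta\<close> because it is a sum of exponentials
  \<open>x \<mapsto> n powr (-x)\<close>, to which Hoelder's inequality applies. Hence \<open>f\<close> is convex on
  \<open>x > 1\<close>.

  The quotient \<open>f x / x\<close> is the slope of the chord from the origin to the graph of \<open>f\<close>. For a
  convex function, once this slope has risen between two points it goes on rising strictly. It
  therefore suffices to see a single rise that ends at the left endpoint 6. The rise is visible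
  between 5 and 6: as \<open>Gamma\<close> takes the values 5! and 6! there, \<open>f 5 / 5 < f 6 / 6\<close> amounts to
  \<open>(240 * zeta 5)^6 < (1440 * zeta 6)^5\<close>, and the crude bounds \<open>zeta 5 < 7 / 4\<close> and
  \<open>zeta 6 \<ge> 1\<close> are enough for that.
\<close>

lemma zeta_ge_1:
  assumes "x > 1"
  shows "zeta x \<ge> 1"
proof -
  have "(\<Sum>n\<in>{0}. 1 / real (Suc n) powr x) \<le> zeta x"
    unfolding zeta_def by (rule sum_le_suminf[OF zeta_summable[OF assms]]) auto
  then show ?thesis by simp
qed

text \<open>
  This is Hoelder's inequality for the series of \<open>zeta\<close>. Dividing the terms of the two outer
  series by their sums \<open>zeta x\<close> and \<open>zeta y\<close> turns them into probability weights; Young's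
  inequality bounds each term of the middle series by a convex combination of these, and the
  combination sums to 1.
\<close>

lemma zeta_log_convex:
  assumes "x > 1" "y > 1" "u \<ge> 0" "v \<ge> 0" "u + v = 1"
  shows "zeta (u * x + v * y) \<le> zeta x powr u * zeta y powr v"
proof -
  let ?t = "\<lambda>s n. 1 / real (Suc n) powr s"
  define A B where "A = zeta x" and "B = zeta y"
  have pos: "A > 0" "B > 0"
    using zeta_ge_1[of x] zeta_ge_1[of y] assms unfolding A_def B_def by auto
  have sums: "?t x sums A" "?t y sums B"
    using zeta_summable[of x] zeta_summable[of y] assms
    unfolding A_def B_def zeta_def by (auto intro: summable_sums)
  have "u * x + v * y > 1"
  proof -
    have "u * (x - 1) + v * (y - 1) > 0"
    proof (cases "u = 0")
      case False
      then show ?thesis using assms by (intro add_pos_nonneg mult_pos_pos) auto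
    qed (use assms in auto)
    then show ?thesis using assms by (simp add: algebra_simps)
  qed
  then have sm: "?t (u * x + v * y) sums zeta (u * x + v * y)"
    unfolding zeta_def by (intro summable_sums zeta_summable)
  have term_le: "?t (u * x + v * y) n / (A powr u * B powr v) \<le> u * (?t x n / A) + v * (?t y n / B)" for n
  proof -
    have "?t (u * x + v * y) n / (A powr u * B powr v) = (?t x n / A) powr u * (?t y n / B) powr v"
      using pos by (simp add: powr_divide powr_mult powr_powr powr_add mult.commute)
    also have "\<dots> \<le> u * (?t x n / A) + v * (?t y n / B)"
      using assms pos by (intro Youngs_inequality_0) auto
    finally show ?thesis .
  qed
  have "zeta (u * x + v * y) / (A powr u * B powr v) \<le> u * (A / A) + v * (B / B)"
    by (rule sums_le[OF _ sums_divide[OF sm] sums_add[OF sums_mult[OF sums_divide[OF sums(1)]]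
          sums_mult[OF sums_divide[OF sums(2)]]]]) (rule term_le)
  then show ?thesis
    using pos assms(5) by (simp add: A_def B_def pos_divide_le_eq)
qed

lemma convex_on_ln_zeta: "convex_on {1<..} (\<lambda>x. ln (zeta x))"
proof (rule convex_onI)
  fix t x y :: real
  assume t: "0 < t" "t < 1" and xy: "x \<in> {1<..}" "y \<in> {1<..}"
  have z: "zeta x \<ge> 1" "zeta y \<ge> 1" using xy zeta_ge_1 by auto
  have mid: "(1 - t) * x + t * y > 1"
    using convexD[OF convex_real_interval(3)[of 1], of x y "1 - t" t] t xy by auto
  have "ln (zeta ((1 - t) * x + t * y)) \<le> ln (zeta x powr (1 - t) * zeta y powr t)"
  proof (rule ln_mono)
    show "zeta ((1 - t) * x + t * y) > 0"
      using zeta_ge_1[OF mid] by linarith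
  qed (use zeta_log_convex[of x y "1 - t" t] t xy in auto)
  also have "\<dots> = (1 - t) * ln (zeta x) + t * ln (zeta y)"
    using z by (simp add: ln_mult)
  finally show "ln (zeta ((1 - t) *\<^sub>R x + t *\<^sub>R y)) \<le> (1 - t) * ln (zeta x) + t * ln (zeta y)"
    by simp
qed auto

lemma convex_on_ln_Gamma_shift: "convex_on {1<..} (\<lambda>x::real. ln (Gamma (x + 1)))"
proof (rule convex_onI)
  fix t x y :: real
  assume t: "0 < t" "t < 1" and xy: "x \<in> {1<..}" "y \<in> {1<..}"
  have e: "(1 - t) *\<^sub>R x + t *\<^sub>R y + 1 = (1 - t) *\<^sub>R (x + 1) + t *\<^sub>R (y + 1)"
    by (simp add: algebra_simps)
  show "ln (Gamma ((1 - t) *\<^sub>R x + t *\<^sub>R y + 1)) \<le>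
      (1 - t) * ln (Gamma (x + 1)) + t * ln (Gamma (y + 1))"
    unfolding e using convex_onD[OF log_convex_Gamma_real, of t "x + 1" "y + 1"] t xy by simp
qed auto

text \<open>
  The three points \<open>(a, f a)\<close>, \<open>(x, f x)\<close> and \<open>(y, f y)\<close> are seen from the origin. The first
  lies below the ray through the second, so by convexity the third must lie above it.
\<close>

lemma convex_on_quotient_less:
  fixes f :: "real \<Rightarrow> real"
  assumes f: "convex_on S f" and S: "a \<in> S" "y \<in> S" and le: "0 < a" "a < x" "x < y"
    and less: "f a / a < f x / x"
  shows "f x / x < f y / y"
proof -
  define c where "c = f x / x"
  define t where "t = (x - a) / (y - a)"
  have t: "0 < t" "t < 1" using le by (auto simp: t_def)
  have "t * (y - a) = x - a" using le by (simp add: t_def)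
  then have x: "x = (1 - t) * a + t * y" by (simp add: algebra_simps)
  have "c * x = f x" using le by (simp add: c_def)
  also have "\<dots> \<le> (1 - t) * f a + t * f y"
    using convex_onD[OF f, of t a y] t S by (simp flip: x)
  also have "\<dots> < (1 - t) * (c * a) + t * f y"
  proof -
    have "f a < c * a" using less le(1) by (simp add: c_def pos_divide_less_eq)
    then show ?thesis using t by simp
  qed
  finally have "t * (c * y) < t * f y"
    by (subst (asm) x) (simp add: algebra_simps)
  then have "c * y < f y" using t by simp
  then show ?thesis using le by (simp add: c_def pos_less_divide_eq)
qed

text \<open>
  Except for the first, the terms of \<open>zeta 5\<close> are at most an eighth of those of \<open>zeta 2\<close>, which
  is \<open>pi^2 / 6\<close>. Hence \<open>zeta 5 \<le> 7 / 8 + pi^2 / 48\<close>, and the bound \<open>pi < 4\<close> suffices.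
\<close>

lemma zeta_5_less: "zeta 5 < 7 / 4"
proof -
  have majorant: "(\<lambda>n. 1 / 8 * (1 / (real n + 1)\<^sup>2) + (if n = 0 then 7 / 8 else 0))
      sums (1 / 8 * (pi\<^sup>2 / 6) + 7 / 8)"
    using inverse_squares_sums sums_single[of 0 "\<lambda>_. 7 / 8 :: real"]
    by (intro sums_add sums_mult) (auto simp: add.commute)
  have series: "(\<lambda>n. 1 / real (Suc n) powr 5) sums zeta 5"
    unfolding zeta_def by (intro summable_sums zeta_summable) simp
  have term_le: "1 / real (Suc n) powr 5 \<le> 1 / 8 * (1 / (real n + 1)\<^sup>2) + (if n = 0 then 7 / 8 else 0)" for n
  proof (cases "n = 0")
    case False
    define m where "m = real n + 1"
    have m: "m \<ge> 2" using False by (simp add: m_def)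
    have "2 ^ 3 * m\<^sup>2 \<le> m ^ 3 * m\<^sup>2"
      using m by (intro mult_right_mono power_mono) auto
    then have "8 * m\<^sup>2 \<le> m ^ 5" by (simp flip: power_add)
    then have "1 / m ^ 5 \<le> 1 / (8 * m\<^sup>2)" using m by (intro divide_left_mono) auto
    moreover have "real (Suc n) powr 5 = m ^ 5"
      using m by (simp add: m_def add.commute powr_numeral)
    ultimately show ?thesis using False by (simp add: m_def)
  qed simp
  have "zeta 5 \<le> 1 / 8 * (pi\<^sup>2 / 6) + 7 / 8"
    by (rule sums_le[OF term_le series majorant])
  moreover have "pi\<^sup>2 < 4\<^sup>2"
    using pi_less_4 pi_gt_zero by (intro power_strict_mono) auto
  ultimately show ?thesis by simp
qed

lemma ln_theta_eq:
  assumes "x > 1"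
  shows "ln (theta x) = (ln (zeta x) + ln (Gamma (x + 1)) + ln 2) / x"
proof -
  have "zeta x > 0" "Gamma (x + 1) > 0"
    using zeta_ge_1[OF assms] assms by (auto intro: Gamma_real_pos)
  then show ?thesis by (simp add: theta_def ln_mult add_ac)
qed

lemma ln_theta_5_less_6: "ln (theta 5) < ln (theta 6)"
proof -
  have z: "1 \<le> zeta 5" "1 \<le> zeta 6" using zeta_ge_1 by auto
  have G: "Gamma 6 = (120 :: real)" "Gamma 7 = (720 :: real)"
    using Gamma_fact[of 5, where 'a = real] Gamma_fact[of 6, where 'a = real]
    by (simp_all add: fact_numeral)
  have "(240 * zeta 5) ^ 6 < (240 * (7 / 4)) ^ 6"
    using zeta_5_less z by (intro power_strict_mono) auto
  also have "\<dots> \<le> (1440 :: real) ^ 5" by simp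
  also have "\<dots> \<le> (1440 * zeta 6) ^ 5"
    using z by (intro power_mono) auto
  finally have "ln ((240 * zeta 5) ^ 6) < ln ((1440 * zeta 6) ^ 5)"
    using z by (subst ln_less_cancel_iff) auto
  then have "6 * ln (240 * zeta 5) < 5 * ln (1440 * zeta 6)"
    using z by (simp only: ln_realpow)
  then show ?thesis
    using z by (simp add: theta_def G mult.commute)
qed

theorem theorem3p1:
  shows "strict_mono_on {6..} (\<lambda>x::real. ln (theta x))"
proof (rule strict_mono_onI)
  fix x y :: real
  assume xy: "x \<in> {6..}" "y \<in> {6..}" "x < y"
  define f where "f = (\<lambda>x. ln (zeta x) + ln (Gamma (x + 1)) + ln 2)"
  have f: "convex_on {1<..} f"
    unfolding f_def
    by (intro convex_on_add convex_on_ln_zeta convex_on_ln_Gamma_shift convex_on_const[THEN iffD2]) auto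
  have eq: "ln (theta z) = f z / z" if "z > 1" for z
    using ln_theta_eq[OF that] by (simp add: f_def)
  have "f 5 / 5 < f 6 / 6"
    using ln_theta_5_less_6 by (simp add: eq)
  moreover from this have "f 6 / 6 < f x / x" if "x \<noteq> 6"
    using convex_on_quotient_less[OF f, of 5 x 6] that xy by simp
  ultimately have "f 5 / 5 < f x / x" by force
  then have "f x / x < f y / y"
    using convex_on_quotient_less[OF f, of 5 y x] xy by simp
  then show "ln (theta x) < ln (theta y)"
    using xy by (simp add: eq)
qed

end
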